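(* Let $k\ge1$ and let $\mathcal{C}$ be a minimal class of $\mathrm{Ind}(\Omega_k)$. Then (1) $\downarrow\mathcal{C}$ is well-quasi-ordered under embedding, and (2) there exists an infinite indecomposable binary structure $\mathcal{R}$ of type $k$ such that $\mathrm{Age}(\mathcal{R})=\downarrow\mathcal{C}$.
   Context: A binary structure of type $k$ is $(E,\rho_1,\dots,\rho_k)$ with binary relations $\rho_i$ on $E$; $\Omega_k$ is the class of finite ones up to isomorphism. $A\subseteq E$ is an interval if for all $i$, $a,a'\in A$, $x\notin A$: $x\rho_i a\Leftrightarrow x\rho_i a'$ and $a\rho_i x\Leftrightarrow a'\rho_i x$; indecomposable means the only intervals are $\emptyset$, singletons and $E$. $\mathrm{Ind}(\Omega_k)$ is the class of indecomposable members of $\Omega_k$. Embedding: isomorphism onto a restriction. A subclass of $\mathrm{Ind}(\Omega_k)$ is hereditary in $\mathrm{Ind}(\Omega_k)$ if it contains every member of $\mathrm{Ind}(\Omega_k)$ embeddable into one of its members; it is minimal if it is hereditary in $\mathrm{Ind}(\Omega_k)$, infinite, and every proper subclass hereditary in $\mathrm{Ind}(\Omega_k)$ is finite. $\downarrow\mathcal{C}$ is the class of all members of $\Omega_k$ embeddable into some member of $\mathcal{C}$. $\mathrm{Age}(\mathcal{R})$ is the class of finite restrictions of $\mathcal{R}$ up to isomorphism. *)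

theory Defs
  imports Main
begin

section \<open>Binary structures\<close>

text \<open>The type of the structure is the number of its relations.\<close>

datatype 'a bstruct = BStruct (base: "'a set") (rels: "('a \<times> 'a) set list")

definition binary_structure :: "nat \<Rightarrow> 'a bstruct \<Rightarrow> bool" where
  "binary_structure k S \<longleftrightarrow>
     length (rels S) = k \<and> (\<forall>r \<in> set (rels S). r \<subseteq> base S \<times> base S)"

definition restr :: "'a bstruct \<Rightarrow> 'a set \<Rightarrow> 'a bstruct" where
  "restr S A = BStruct (base S \<inter> A) (map (\<lambda>r. r \<inter> (A \<times> A)) (rels S))"

definition isomorphic :: "'a bstruct \<Rightarrow> 'b bstruct \<Rightarrow> bool" where
  "isomorphic S T \<longleftrightarrow> length (rels S) = length (rels T) \<and>
     (\<exists>f. bij_betw f (base S) (base T) \<and>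
        (\<forall>i < length (rels S). \<forall>x \<in> base S. \<forall>y \<in> base S.
           (x, y) \<in> rels S ! i \<longleftrightarrow> (f x, f y) \<in> rels T ! i))"

definition embeds :: "'a bstruct \<Rightarrow> 'b bstruct \<Rightarrow> bool" where
  "embeds S T \<longleftrightarrow> (\<exists>A \<subseteq> base T. isomorphic S (restr T A))"

definition interval :: "'a bstruct \<Rightarrow> 'a set \<Rightarrow> bool" where
  "interval S A \<longleftrightarrow> A \<subseteq> base S \<and>
     (\<forall>r \<in> set (rels S). \<forall>a \<in> A. \<forall>a' \<in> A. \<forall>x \<in> base S - A.
        ((x, a) \<in> r \<longleftrightarrow> (x, a') \<in> r) \<and> ((a, x) \<in> r \<longleftrightarrow> (a', x) \<in> r))"

definition indecomposable :: "'a bstruct \<Rightarrow> bool" where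
  "indecomposable S \<longleftrightarrow>
     (\<forall>A. interval S A \<longrightarrow> A = {} \<or> (\<exists>x. A = {x}) \<or> A = base S)"


section \<open>Finite structures up to isomorphism\<close>

text \<open>
  An isomorphism type is the set of all structures on subsets of \<open>nat\<close> that are isomorphic to a
  given finite structure. The given structure may live on any type, so that isomorphism types of
  structures on different types can be compared. The empty structure is included.
\<close>

type_synonym itype = "nat bstruct set"

definition iso_type :: "'a bstruct \<Rightarrow> itype" where
  "iso_type S = {T. binary_structure (length (rels S)) T \<and> isomorphic S T}"

definition Omega :: "nat \<Rightarrow> itype set" where
  "Omega k = {iso_type S |S :: nat bstruct. binary_structure k S \<and> finite (base S)}"

definition Ind_Omega :: "nat \<Rightarrow> itype set" where
  "Ind_Omega k =
     {iso_type S |S :: nat bstruct. binary_structure k S \<and> finite (base S) \<and> indecomposable S}"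

text \<open>
  On members of \<open>Omega k\<close> this does not depend on the representatives; see
  \<open>emb_le_iso_type_iff\<close> below.
\<close>

definition emb_le :: "itype \<Rightarrow> itype \<Rightarrow> bool" where
  "emb_le X Y \<longleftrightarrow> (\<exists>S \<in> X. \<exists>T \<in> Y. embeds S T)"

definition hereditary_in_Ind :: "nat \<Rightarrow> itype set \<Rightarrow> bool" where
  "hereditary_in_Ind k C \<longleftrightarrow> C \<subseteq> Ind_Omega k \<and>
     (\<forall>X \<in> Ind_Omega k. \<forall>Y \<in> C. emb_le X Y \<longrightarrow> X \<in> C)"

definition minimal_class :: "nat \<Rightarrow> itype set \<Rightarrow> bool" where
  "minimal_class k C \<longleftrightarrow> hereditary_in_Ind k C \<and> infinite C \<and>
     (\<forall>D. D \<subset> C \<and> hereditary_in_Ind k D \<longrightarrow> finite D)"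

definition down :: "nat \<Rightarrow> itype set \<Rightarrow> itype set" where
  "down k C = {X \<in> Omega k. \<exists>Y \<in> C. emb_le X Y}"

definition Age :: "'a bstruct \<Rightarrow> itype set" where
  "Age R = {iso_type (restr R A) |A. A \<subseteq> base R \<and> finite A}"

definition well_quasi_ordered_on :: "'a set \<Rightarrow> ('a \<Rightarrow> 'a \<Rightarrow> bool) \<Rightarrow> bool" where
  "well_quasi_ordered_on A le \<longleftrightarrow>
     (\<forall>x \<in> A. le x x) \<and>
     (\<forall>x \<in> A. \<forall>y \<in> A. \<forall>z \<in> A. le x y \<longrightarrow> le y z \<longrightarrow> le x z) \<and>
     (\<forall>f :: nat \<Rightarrow> 'a. (\<forall>n. f n \<in> A) \<longrightarrow> (\<exists>i j. i < j \<and> le (f i) (f j)))"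


section \<open>Independence of representatives\<close>

lemma isomorphic_refl: "isomorphic S S"
  unfolding isomorphic_def by (intro conjI refl exI[of _ id]) simp_all

lemma isomorphic_sym:
  assumes "isomorphic S T" shows "isomorphic T S"
proof -
  obtain f where l: "length (rels S) = length (rels T)" and f: "bij_betw f (base S) (base T)"
    and r: "\<And>i x y. i < length (rels S) \<Longrightarrow> x \<in> base S \<Longrightarrow> y \<in> base S \<Longrightarrow>
           (x, y) \<in> rels S ! i \<longleftrightarrow> (f x, f y) \<in> rels T ! i"
    using assms unfolding isomorphic_def by blast
  let ?g = "inv_into (base S) f"
  have g: "bij_betw ?g (base T) (base S)" using f by (rule bij_betw_inv_into)
  have fg: "f (?g x) = x" if "x \<in> base T" for x
    using f that by (simp add: bij_betw_inv_into_right)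
  have "?g x \<in> base S" if "x \<in> base T" for x using g that by (rule bij_betw_apply)
  then show ?thesis unfolding isomorphic_def using l g r fg
    by (intro conjI exI[of _ ?g]) simp_all
qed

lemma isomorphic_trans:
  assumes "isomorphic S T" "isomorphic T U" shows "isomorphic S U"
proof -
  obtain f where f: "length (rels S) = length (rels T)" "bij_betw f (base S) (base T)"
    "\<And>i x y. i < length (rels S) \<Longrightarrow> x \<in> base S \<Longrightarrow> y \<in> base S \<Longrightarrow>
           (x, y) \<in> rels S ! i \<longleftrightarrow> (f x, f y) \<in> rels T ! i"
    using assms(1) unfolding isomorphic_def by blast
  obtain g where g: "length (rels T) = length (rels U)" "bij_betw g (base T) (base U)"
    "\<And>i x y. i < length (rels T) \<Longrightarrow> x \<in> base T \<Longrightarrow> y \<in> base T \<Longrightarrow>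
           (x, y) \<in> rels T ! i \<longleftrightarrow> (g x, g y) \<in> rels U ! i"
    using assms(2) unfolding isomorphic_def by blast
  have "f x \<in> base T" if "x \<in> base S" for x using f(2) that by (rule bij_betw_apply)
  then show ?thesis unfolding isomorphic_def using f g bij_betw_trans[OF f(2) g(2)]
    by (intro conjI exI[of _ "g \<circ> f"]) (simp_all add: image_comp[symmetric] subset_iff)
qed

lemma iso_type_eq_iff:
  fixes S T :: "nat bstruct"
  assumes "binary_structure k S" "binary_structure k T"
  shows "iso_type S = iso_type T \<longleftrightarrow> isomorphic S T"
proof
  assume "iso_type S = iso_type T"
  moreover have "T \<in> iso_type T"
    using assms(2) by (simp add: iso_type_def binary_structure_def isomorphic_refl)
  ultimately have "T \<in> iso_type S" by simp
  then show "isomorphic S T" by (simp add: iso_type_def)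
next
  assume "isomorphic S T"
  then have "isomorphic S U \<longleftrightarrow> isomorphic T U" for U :: "nat bstruct"
    by (meson isomorphic_sym isomorphic_trans)
  then show "iso_type S = iso_type T"
    using assms by (simp add: iso_type_def binary_structure_def)
qed

lemma embeds_iff:
  "embeds S T \<longleftrightarrow> length (rels S) = length (rels T) \<and>
     (\<exists>f. inj_on f (base S) \<and> f ` base S \<subseteq> base T \<and>
        (\<forall>i < length (rels S). \<forall>x \<in> base S. \<forall>y \<in> base S.
           (x, y) \<in> rels S ! i \<longleftrightarrow> (f x, f y) \<in> rels T ! i))"
  (is "?L \<longleftrightarrow> ?R")
proof
  assume ?L
  then obtain A f where A: "A \<subseteq> base T" and l: "length (rels S) = length (rels T)"
    and f: "bij_betw f (base S) (base T \<inter> A)"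
    and r: "\<forall>i < length (rels S). \<forall>x \<in> base S. \<forall>y \<in> base S.
           (x, y) \<in> rels S ! i \<longleftrightarrow> (f x, f y) \<in> map (\<lambda>r. r \<inter> (A \<times> A)) (rels T) ! i"
    unfolding embeds_def isomorphic_def restr_def bstruct.sel length_map by blast
  have "f x \<in> base T \<inter> A" if "x \<in> base S" for x using f that by (rule bij_betw_apply)
  moreover from this have "f ` base S \<subseteq> base T" by blast
  ultimately show ?R using l f r
    by (intro conjI exI[of _ f]) (simp_all add: bij_betw_imp_inj_on)
next
  assume ?R
  then obtain f where f: "length (rels S) = length (rels T)" "inj_on f (base S)"
    "f ` base S \<subseteq> base T"
    "\<forall>i < length (rels S). \<forall>x \<in> base S. \<forall>y \<in> base S.
           (x, y) \<in> rels S ! i \<longleftrightarrow> (f x, f y) \<in> rels T ! i" by blast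
  have "isomorphic S (restr T (f ` base S))"
    unfolding isomorphic_def restr_def using f(1,2,4)
    by (intro conjI exI[of _ f]) (simp_all add: bij_betw_def Int_absorb1[OF f(3)])
  with f(3) show ?L unfolding embeds_def by blast
qed

lemma embeds_trans:
  assumes "embeds S T" "embeds T U" shows "embeds S U"
proof -
  obtain f where f: "length (rels S) = length (rels T)" "inj_on f (base S)"
    "f ` base S \<subseteq> base T"
    "\<forall>i < length (rels S). \<forall>x \<in> base S. \<forall>y \<in> base S.
           (x, y) \<in> rels S ! i \<longleftrightarrow> (f x, f y) \<in> rels T ! i"
    using assms(1) unfolding embeds_iff by blast
  obtain g where g: "length (rels T) = length (rels U)" "inj_on g (base T)"
    "g ` base T \<subseteq> base U"
    "\<forall>i < length (rels T). \<forall>x \<in> base T. \<forall>y \<in> base T.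
           (x, y) \<in> rels T ! i \<longleftrightarrow> (g x, g y) \<in> rels U ! i"
    using assms(2) unfolding embeds_iff by blast
  have "inj_on (g \<circ> f) (base S)" using f(2,3) g(2) by (meson comp_inj_on inj_on_subset)
  moreover have "f x \<in> base T" if "x \<in> base S" for x using f(3) that by blast
  moreover from this have "(g \<circ> f) ` base S \<subseteq> base U" using g(3) by fastforce
  ultimately show ?thesis unfolding embeds_iff using f(1,4) g(1,4)
    by (intro conjI exI[of _ "g \<circ> f"]) simp_all
qed

lemma isomorphic_imp_embeds: "isomorphic S T \<Longrightarrow> embeds S T"
  unfolding embeds_iff isomorphic_def by (metis bij_betw_imp_inj_on bij_betw_imp_surj_on order_refl)

lemma emb_le_iso_type_iff:
  fixes S T :: "nat bstruct"
  assumes "binary_structure k S" "binary_structure k T"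
  shows "emb_le (iso_type S) (iso_type T) \<longleftrightarrow> embeds S T"
proof
  assume "emb_le (iso_type S) (iso_type T)"
  then obtain S' T' :: "nat bstruct" where "isomorphic S S'" "isomorphic T T'" "embeds S' T'"
    unfolding emb_le_def iso_type_def by blast
  then show "embeds S T"
    by (meson embeds_trans isomorphic_imp_embeds isomorphic_sym)
next
  assume "embeds S T"
  moreover have "S \<in> iso_type S" "T \<in> iso_type T"
    using assms by (auto simp: iso_type_def binary_structure_def isomorphic_refl)
  ultimately show "emb_le (iso_type S) (iso_type T)" unfolding emb_le_def by blast
qed

end

theory Submission
  imports Defs "HOL-Library.Ramsey"
begin

text \<open>
  By minimality, each member \<open>X\<close> of \<open>C\<close> embeds into all but finitely many members of \<open>C\<close>: those into
  which it does not embed form a proper hereditary subclass.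

  (1) The same argument applies to \<open>X\<close> in \<open>down k C\<close>. Hence in a bad sequence every term after the
  first omits the first one, so its indecomposable restrictions have bounded size. A finite structure
  with at least two elements is a lexicographic sum over an indecomposable quotient, which is
  isomorphic to a restriction. With quotients of bounded size, the arities of these sums are bounded,
  and a minimal bad sequence together with Ramsey's theorem gives a contradiction.

  (2) Any strictly increasing chain of members of \<open>C\<close> is cofinal in \<open>C\<close>, and its union is
  indecomposable.
\<close>

section \<open>Bad sequences\<close>

definition bad_seq :: "'a set \<Rightarrow> ('a \<Rightarrow> 'a \<Rightarrow> bool) \<Rightarrow> (nat \<Rightarrow> 'a) \<Rightarrow> bool" where
  "bad_seq A le f \<longleftrightarrow> (\<forall>n. f n \<in> A) \<and> (\<forall>i j. i < j \<longrightarrow> \<not> le (f i) (f j))"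

text \<open>Nash-Williams' construction: the terms are fixed one after another, each of least
  \<open>size\<close> among the bad sequences that continue the terms already fixed.\<close>

lemma minimal_bad_seq:
  fixes size :: "'a \<Rightarrow> nat"
  assumes "bad_seq A le f"
  obtains g where "bad_seq A le g"
    and "\<And>n h. bad_seq A le h \<Longrightarrow> (\<And>i. i < n \<Longrightarrow> h i = g i) \<Longrightarrow> size (g n) \<le> size (h n)"
proof -
  \<comment> \<open>Whole bad sequences are carried through the recursion: \<open>?P n F\<close>
    makes term \<open>n\<close> of \<open>F\<close> least, and \<open>?Q\<close> keeps the terms up
    to \<open>n\<close> afterwards. The diagonal is the sequence sought.\<close>
  let ?P = "\<lambda>n F. bad_seq A le F \<and>
    (\<forall>h. bad_seq A le h \<longrightarrow> (\<forall>i<n. h i = F i) \<longrightarrow> size (F n) \<le> size (h n))"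
  let ?Q = "\<lambda>n F F'. \<forall>i\<le>n. F' i = F i"
  have step: "\<exists>F'. ?P n F' \<and> (\<forall>i<n. F' i = F i)" if F: "bad_seq A le F" for F n
  proof -
    obtain F' where F': "bad_seq A le F' \<and> (\<forall>i<n. F' i = F i)"
      and min: "\<And>h. bad_seq A le h \<and> (\<forall>i<n. h i = F i) \<Longrightarrow> size (F' n) \<le> size (h n)"
      using ex_has_least_nat[of "\<lambda>h. bad_seq A le h \<and> (\<forall>i<n. h i = F i)" F "\<lambda>h. size (h n)"] F
      by blast
    have "?P n F'" using F' min by metis
    with F' show ?thesis by blast
  qed
  have "\<exists>F. \<forall>n. ?P n (F n) \<and> ?Q n (F n) (F (Suc n))"
  proof (rule dependent_nat_choice)
    show "\<exists>F. ?P 0 F" using step[OF assms, of 0] by blast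
    show "\<exists>F'. ?P (Suc n) F' \<and> ?Q n F F'" if "?P n F" for F n
      using step[of F "Suc n"] that by (auto simp: less_Suc_eq_le)
  qed
  then obtain F where F: "\<And>n. ?P n (F n)" and Q: "\<And>n. ?Q n (F n) (F (Suc n))" by blast
  \<comment> \<open>So the diagonal agrees with \<open>F m\<close> up to place \<open>m\<close>,
    from which it inherits badness and minimality there.\<close>
  have agree: "F m i = F i i" if "i \<le> m" for i m
    using that by (induction rule: dec_induct) (use Q in auto)
  show thesis
  proof
    show "bad_seq A le (\<lambda>n. F n n)"
      unfolding bad_seq_def
    proof (intro conjI allI impI)
      show "F n n \<in> A" for n using F[of n] by (simp add: bad_seq_def)
      show "\<not> le (F i i) (F j j)" if "i < j" for i j
        using F[of j] that agree[of i j] unfolding bad_seq_def by (metis less_imp_le)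
    qed
    show "size (F n n) \<le> size (h n)"
      if "bad_seq A le h" "\<And>i. i < n \<Longrightarrow> h i = F i i" for n h
      using F[of n] that agree by (metis less_imp_le)
  qed
qed

text \<open>A bad sequence \<open>h\<close> of elements strictly below terms of \<open>g\<close>
  could replace a tail of \<open>g\<close>; the result would be bad and smaller at the first changed
  place.\<close>

lemma minimal_bad_seq_below:
  fixes size :: "'a \<Rightarrow> nat"
  assumes "bad_seq A le f"
    and trans: "\<And>x y z. le x y \<Longrightarrow> le y z \<Longrightarrow> le x z"
  obtains g where "bad_seq A le g"
    and "\<And>h. \<not> bad_seq {x \<in> A. \<exists>n. le x (g n) \<and> size x < size (g n)} le h"
proof -
  obtain g where g: "bad_seq A le g"
    and min: "\<And>n h. bad_seq A le h \<Longrightarrow> (\<And>i. i < n \<Longrightarrow> h i = g i) \<Longrightarrow> size (g n) \<le> size (h n)"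
    using minimal_bad_seq[OF assms(1), of size] by blast
  have False if h: "bad_seq {x \<in> A. \<exists>n. le x (g n) \<and> size x < size (g n)} le h" for h
  proof -
    from h have "\<forall>i. \<exists>n. le (h i) (g n) \<and> size (h i) < size (g n)"
      by (simp add: bad_seq_def)
    then obtain N where N: "\<And>i. le (h i) (g (N i))" "\<And>i. size (h i) < size (g (N i))" by metis
    \<comment> \<open>The tail of \<open>h\<close> from \<open>i0\<close> on is attached at the
      least index \<open>N i0\<close>. Then each \<open>h i\<close> lies below a term of
      \<open>g\<close> with index at least \<open>N i0\<close>, so no earlier term of
      \<open>g\<close> can lie below \<open>h i\<close>.\<close>
    obtain i0 where i0: "\<And>i. N i0 \<le> N i"
      using ex_has_least_nat[of "\<lambda>_. True" 0 N] by auto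
    define q where "q i = (if i < N i0 then g i else h (i - N i0 + i0))" for i
    have "bad_seq A le q"
      unfolding bad_seq_def
    proof (intro conjI allI impI)
      show "q n \<in> A" for n using g h by (simp add: q_def bad_seq_def)
      show "\<not> le (q i) (q j)" if ij: "i < j" for i j
      proof (cases "i < N i0 \<and> \<not> j < N i0")
        case True
        define j' where "j' = j - N i0 + i0"
        have "\<not> le (g i) (h j')"
        proof
          assume "le (g i) (h j')"
          then have "le (g i) (g (N j'))" using N trans by blast
          moreover have "i < N j'" using True i0[of j'] by simp
          ultimately show False using g by (simp add: bad_seq_def)
        qed
        then show ?thesis using True by (simp add: q_def j'_def)
      next
        case False
        then show ?thesis using g h ij by (auto simp: q_def bad_seq_def)
      qed
    qed
    from min[OF this, of "N i0"] N(2)[of i0] show False by (simp add: q_def)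
  qed
  then show thesis using g that by blast
qed

text \<open>By Ramsey's theorem: a pair of indices is coloured by a coordinate in which the
  comparison fails, and a homogeneous set yields a bad sequence in that coordinate. \<open>Z\<close>
  will be a set of terms with a common quotient.\<close>

lemma finite_product_good:
  assumes Z: "infinite (Z :: nat set)"
    and B: "\<And>n l. n \<in> Z \<Longrightarrow> l < m \<Longrightarrow> h n l \<in> B"
    and good: "\<And>q. \<not> bad_seq B le q"
  shows "\<exists>i\<in>Z. \<exists>j\<in>Z. i < j \<and> (\<forall>l<(m::nat). le (h i l) (h j l))"
proof (rule ccontr)
  assume no: "\<not> ?thesis"
  have ex: "\<exists>l<m. \<not> le (h i l) (h j l)" if "i \<in> Z" "j \<in> Z" "i < j" for i j
    using that no by blast
  \<comment> \<open>\<open>Ramsey2\<close> colours unordered pairs; \<open>Min\<close> and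
    \<open>Max\<close> recover their order.\<close>
  define col where "col X = (LEAST l. l < m \<and> \<not> le (h (Min X) l) (h (Max X) l))" for X
  have col: "col {i, j} < m \<and> \<not> le (h i (col {i, j})) (h j (col {i, j}))"
    if "i \<in> Z" "j \<in> Z" "i < j" for i j
    using LeastI_ex[OF ex[OF that]] that(3) by (simp add: col_def)
  have "\<forall>x\<in>Z. \<forall>y\<in>Z. x \<noteq> y \<longrightarrow> col {x, y} < m"
    using col by (metis insert_commute linorder_neqE_nat)
  from Ramsey2[OF Z this] obtain Y t where Y: "Y \<subseteq> Z" "infinite Y" and t: "t < m"
    and Yt: "\<forall>x\<in>Y. \<forall>y\<in>Y. x \<noteq> y \<longrightarrow> col {x, y} = t" by blast
  have mono: "strict_mono (enumerate Y)" using Y(2) by (rule strict_mono_enumerate)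
  have inY: "enumerate Y n \<in> Y" for n using Y(2) by (rule enumerate_in_set)
  have "bad_seq B le (\<lambda>n. h (enumerate Y n) t)"
    unfolding bad_seq_def
  proof (intro conjI allI impI)
    show "h (enumerate Y n) t \<in> B" for n using B t inY Y(1) by blast
    show "\<not> le (h (enumerate Y i) t) (h (enumerate Y j) t)" if "i < j" for i j
    proof -
      have "enumerate Y i < enumerate Y j" using mono that by (rule strict_monoD)
      then show ?thesis using col Yt inY Y(1) by (metis less_irrefl subsetD)
    qed
  qed
  with good show False by blast
qed


section \<open>Restrictions\<close>

lemma base_restr [simp]: "base (restr S A) = base S \<inter> A"
  by (simp add: restr_def)

lemma length_rels_restr [simp]: "length (rels (restr S A)) = length (rels S)"
  by (simp add: restr_def)

lemma binary_structure_restr: "binary_structure k S \<Longrightarrow> binary_structure k (restr S A)"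
  unfolding binary_structure_def restr_def by auto

lemma restr_restr: "A \<subseteq> B \<Longrightarrow> restr (restr S B) A = restr S A"
  by (auto simp: restr_def)

lemma restr_base: "binary_structure k S \<Longrightarrow> restr S (base S) = S"
  by (intro bstruct.expand) (auto simp: restr_def binary_structure_def Int_absorb2 intro!: map_idI)

lemma nth_restr:
  "i < length (rels S) \<Longrightarrow> rels (restr S A) ! i = rels S ! i \<inter> (A \<times> A)"
  by (simp add: restr_def)

lemma restr_eqI:
  assumes "length (rels S) = length (rels T)" "base T \<subseteq> base S"
    and "\<And>i. i < length (rels T) \<Longrightarrow> rels S ! i \<inter> (base T \<times> base T) = rels T ! i"
  shows "restr S (base T) = T"
proof (rule bstruct.expand, rule conjI)
  show "base (restr S (base T)) = base T" using assms(2) by auto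
  show "rels (restr S (base T)) = rels T"
    using assms(1,3) by (intro nth_equalityI) (simp_all add: nth_restr)
qed

lemma embeds_restr: "A \<subseteq> base S \<Longrightarrow> embeds (restr S A) S"
  unfolding embeds_def using isomorphic_refl by blast

lemma intervalD:
  assumes "interval S A" "r \<in> set (rels S)" "a \<in> A" "a' \<in> A" "x \<in> base S" "x \<notin> A"
  shows "(x, a) \<in> r \<longleftrightarrow> (x, a') \<in> r" "(a, x) \<in> r \<longleftrightarrow> (a', x) \<in> r"
  using assms unfolding interval_def by blast+

lemma interval_restr:
  assumes "interval S A" shows "interval (restr S B) (A \<inter> B)"
  unfolding interval_def
proof (intro conjI ballI)
  show "A \<inter> B \<subseteq> base (restr S B)" using assms by (auto simp: interval_def)
  fix q a a' x
  assume q: "q \<in> set (rels (restr S B))" and a: "a \<in> A \<inter> B" "a' \<in> A \<inter> B"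
    and x: "x \<in> base (restr S B) - A \<inter> B"
  obtain r where r: "r \<in> set (rels S)" "q = r \<inter> (B \<times> B)" using q by (auto simp: restr_def)
  have "a \<in> A" "a' \<in> A" "x \<in> base S" "x \<notin> A" using a x by auto
  note intervalD[OF assms r(1) this]
  then show "(x, a) \<in> q \<longleftrightarrow> (x, a') \<in> q" "(a, x) \<in> q \<longleftrightarrow> (a', x) \<in> q"
    using a x r(2) by simp_all
qed

section \<open>Invariance under isomorphism\<close>

lemma isomorphic_card: "isomorphic S T \<Longrightarrow> card (base S) = card (base T)"
  unfolding isomorphic_def using bij_betw_same_card by blast

lemma isomorphic_finite: "isomorphic S T \<Longrightarrow> finite (base S) \<longleftrightarrow> finite (base T)"
  unfolding isomorphic_def using bij_betw_finite by blast

text \<open>Isomorphisms carry intervals to intervals. This is needed because a member of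
  \<open>Ind_Omega\<close> only supplies some indecomposable representative.\<close>

lemma indecomposable_isomorphic:
  assumes "isomorphic S T" "indecomposable T" shows "indecomposable S"
  unfolding indecomposable_def
proof (intro allI impI)
  fix A assume A: "interval S A"
  obtain f where l: "length (rels S) = length (rels T)" and f: "bij_betw f (base S) (base T)"
    and r: "\<And>i x y. i < length (rels S) \<Longrightarrow> x \<in> base S \<Longrightarrow> y \<in> base S \<Longrightarrow>
           (x, y) \<in> rels S ! i \<longleftrightarrow> (f x, f y) \<in> rels T ! i"
    using assms(1) unfolding isomorphic_def by blast
  have inj: "inj_on f (base S)" and im: "f ` base S = base T" using f by (auto simp: bij_betw_def)
  have sub: "A \<subseteq> base S" using A by (simp add: interval_def)
  have "interval T (f ` A)"
    unfolding interval_def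
  proof (intro conjI ballI)
    show "f ` A \<subseteq> base T" using sub im by blast
    fix r b b' z assume rT: "r \<in> set (rels T)" and "b \<in> f ` A" "b' \<in> f ` A" "z \<in> base T - f ` A"
    then obtain a a' x where x: "b = f a" "b' = f a'" "z = f x" "a \<in> A" "a' \<in> A" "x \<in> base S - A"
      using im by blast
    obtain i where i: "i < length (rels S)" "r = rels T ! i" using rT l by (metis in_set_conv_nth)
    have "rels S ! i \<in> set (rels S)" using i by simp
    then have "((x, a) \<in> rels S ! i \<longleftrightarrow> (x, a') \<in> rels S ! i) \<and>
      ((a, x) \<in> rels S ! i \<longleftrightarrow> (a', x) \<in> rels S ! i)"
      using intervalD[OF A, of _ a a' x] x by blast
    moreover have "a \<in> base S" "a' \<in> base S" "x \<in> base S" using x sub by auto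
    ultimately show "(z, b) \<in> r \<longleftrightarrow> (z, b') \<in> r" "(b, z) \<in> r \<longleftrightarrow> (b', z) \<in> r"
      using r[OF i(1)] i(2) x by auto
  qed
  with assms(2) have "f ` A = {} \<or> (\<exists>x. f ` A = {x}) \<or> f ` A = base T"
    unfolding indecomposable_def by blast
  then show "A = {} \<or> (\<exists>x. A = {x}) \<or> A = base S"
  proof (elim disjE exE)
    assume "f ` A = {}" then show ?thesis by simp
  next
    fix y assume y: "f ` A = {y}"
    then obtain x where "x \<in> A" by blast
    moreover have "x' = x" if "x' \<in> A" for x'
      using y that \<open>x \<in> A\<close> inj sub by (metis imageI inj_onD singletonD subsetD)
    ultimately show ?thesis by blast
  next
    assume "f ` A = base T"
    then show ?thesis using inj_on_image_eq_iff[OF inj sub order_refl] im by simp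
  qed
qed


section \<open>Structures with small indecomposable restrictions\<close>

text \<open>
  The map \<open>c\<close> sends each point to a representative of its class in a partition into intervals. If the
  number of classes is minimal subject to being at least two, the quotient is indecomposable, because
  a nontrivial interval of it could be collapsed to a point.
\<close>

lemma indecomposable_quotient:
  assumes fin: "finite (base S)" and card: "2 \<le> card (base S)"
  obtains c where "\<And>x. x \<in> base S \<Longrightarrow> c x \<in> base S"
    and "\<And>r x y. r \<in> set (rels S) \<Longrightarrow> x \<in> base S \<Longrightarrow> y \<in> base S \<Longrightarrow> c x \<noteq> c y \<Longrightarrow>
           (x, y) \<in> r \<longleftrightarrow> (c x, c y) \<in> r"
    and "2 \<le> card (c ` base S)" and "indecomposable (restr S (c ` base S))"
proof -
  \<comment> \<open>Idempotence makes the image of \<open>c\<close> a transversal of the classes;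
    the restriction of \<open>S\<close> to it serves as the quotient.\<close>
  define P where "P c \<longleftrightarrow> (\<forall>x \<in> base S. c x \<in> base S \<and> c (c x) = c x) \<and>
    (\<forall>r \<in> set (rels S). \<forall>x \<in> base S. \<forall>y \<in> base S. c x \<noteq> c y \<longrightarrow>
       ((x, y) \<in> r \<longleftrightarrow> (c x, c y) \<in> r)) \<and> 2 \<le> card (c ` base S)" for c
  \<comment> \<open>The partition into singletons is admissible since \<open>S\<close> has at least
    two points, so a least number of classes exists.\<close>
  have "P id" using card by (simp add: P_def)
  then obtain c where c: "P c" and min: "\<And>d. P d \<Longrightarrow> card (c ` base S) \<le> card (d ` base S)"
    using ex_has_least_nat[of P id "\<lambda>c. card (c ` base S)"] by blast
  define A where "A = c ` base S"
  have A: "A \<subseteq> base S" and cA: "\<And>a. a \<in> A \<Longrightarrow> c a = a" using c by (auto simp: A_def P_def)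
  have finA: "finite A" using fin by (simp add: A_def)
  have "I = {} \<or> (\<exists>x. I = {x}) \<or> I = A" if I: "interval (restr S A) I" for I
  proof (rule ccontr)
    assume n: "\<not> ?thesis"
    have IA: "I \<subseteq> A" using I by (simp add: interval_def)
    obtain j where j: "j \<in> I" using n by blast
    obtain j' where j': "j' \<in> I" "j' \<noteq> j" using n j by blast
    obtain a where a: "a \<in> A" "a \<notin> I" using n IA by blast
    have swap: "((x, b) \<in> r \<longleftrightarrow> (x, b') \<in> r) \<and> ((b, x) \<in> r \<longleftrightarrow> (b', x) \<in> r)"
      if "r \<in> set (rels S)" "b \<in> I" "b' \<in> I" "x \<in> A" "x \<notin> I" for r b b' x
    proof -
      have "r \<inter> (A \<times> A) \<in> set (rels (restr S A))" using that by (auto simp: restr_def)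
      moreover have "x \<in> base (restr S A) - I" using that A by auto
      ultimately have "((x, b) \<in> r \<inter> (A \<times> A) \<longleftrightarrow> (x, b') \<in> r \<inter> (A \<times> A)) \<and>
          ((b, x) \<in> r \<inter> (A \<times> A) \<longleftrightarrow> (b', x) \<in> r \<inter> (A \<times> A))"
        using intervalD[OF I, of _ b b' x] that(2,3) by blast
      then show ?thesis using that IA by auto
    qed
    \<comment> \<open>All classes represented in \<open>I\<close> are collapsed to \<open>j\<close>.
      This loses the representative \<open>j'\<close>, so there are fewer classes, while
      \<open>j\<close> and \<open>a\<close> stay distinct, so at least two remain.\<close>
    define d where "d x = (if c x \<in> I then j else c x)" for x
    have jA: "j \<in> A" using j IA by blast
    have dA: "d ` base S \<subseteq> A - {j'}" using jA j' unfolding d_def A_def by auto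
    have "d j = j" "d a = a" using cA jA a j by (simp_all add: d_def)
    then have "{j, a} \<subseteq> d ` base S" using jA a A by (metis empty_subsetI imageI insert_subset subsetD)
    then have "card {j, a} \<le> card (d ` base S)" using fin by (intro card_mono) auto
    then have "2 \<le> card (d ` base S)" using j a by (metis card_2_iff)
    moreover have "d x \<in> base S \<and> d (d x) = d x" if "x \<in> base S" for x
    proof -
      have "c x \<in> A" using that by (simp add: A_def)
      then show ?thesis using cA jA j A by (auto simp: d_def)
    qed
    moreover have "(x, y) \<in> r \<longleftrightarrow> (d x, d y) \<in> r"
      if "r \<in> set (rels S)" "x \<in> base S" "y \<in> base S" "d x \<noteq> d y" for r x y
    proof -
      have ne: "c x \<noteq> c y" using that(4) unfolding d_def by metis
      have "c x \<in> A" "c y \<in> A" using that by (auto simp: A_def)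
      moreover have "(x, y) \<in> r \<longleftrightarrow> (c x, c y) \<in> r" using c ne that unfolding P_def by blast
      ultimately show ?thesis
        using swap[OF that(1) _ j] that(4) by (auto simp: d_def split: if_splits)
    qed
    ultimately have "P d" unfolding P_def by blast
    then have "card A \<le> card (d ` base S)" using min unfolding A_def by blast
    also have "\<dots> \<le> card (A - {j'})" using dA finA by (intro card_mono) auto
    also have "\<dots> < card A" using finA j' IA by (intro card_Diff1_less) auto
    finally show False by simp
  qed
  then have "indecomposable (restr S A)"
    using A by (auto simp: indecomposable_def Int_absorb1)
  with c show thesis using that[of c] unfolding P_def A_def by blast
qed

section \<open>Numbered quotients and lexicographic sums\<close>

text \<open>Numbering the classes makes quotients of different structures comparable, and for
  bounded \<open>m\<close> only finitely many occur. The quotient relation is the image of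
  \<open>r\<close>; it decides \<open>r\<close> between distinct classes.\<close>

definition quotient_map :: "'a bstruct \<Rightarrow> nat \<Rightarrow> ('a \<Rightarrow> nat) \<Rightarrow> bool" where
  "quotient_map S m c \<longleftrightarrow> c ` base S = {..<m} \<and>
     (\<forall>r \<in> set (rels S). \<forall>x \<in> base S. \<forall>y \<in> base S. c x \<noteq> c y \<longrightarrow>
        ((x, y) \<in> r \<longleftrightarrow> (c x, c y) \<in> map_prod c c ` r))"

text \<open>The representatives from \<open>indecomposable_quotient\<close> are numbered;
  \<open>N\<close> bounds their number because they induce an indecomposable restriction of
  \<open>S\<close>.\<close>

lemma indexed_quotient:
  assumes S: "binary_structure k S" "finite (base S)" "2 \<le> card (base S)"
    and bound: "\<And>A. A \<subseteq> base S \<Longrightarrow> indecomposable (restr S A) \<Longrightarrow> card A \<le> N"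
  shows "\<exists>m c. 2 \<le> m \<and> m \<le> N \<and> quotient_map S m c"
proof -
  obtain c where c: "\<And>x. x \<in> base S \<Longrightarrow> c x \<in> base S"
    "\<And>r x y. r \<in> set (rels S) \<Longrightarrow> x \<in> base S \<Longrightarrow> y \<in> base S \<Longrightarrow> c x \<noteq> c y \<Longrightarrow>
       (x, y) \<in> r \<longleftrightarrow> (c x, c y) \<in> r"
    "2 \<le> card (c ` base S)" "indecomposable (restr S (c ` base S))"
    using indecomposable_quotient[OF S(2,3)] by blast
  let ?A = "c ` base S"
  have "?A \<subseteq> base S" using c(1) by blast
  then have "card ?A \<le> N" using bound c(4) by blast
  obtain e where e: "bij_betw e ?A {0..<card ?A}"
    using ex_bij_betw_finite_nat[of ?A] S(2) by blast
  have ec: "e (c x) = e (c y) \<longleftrightarrow> c x = c y" if "x \<in> base S" "y \<in> base S" for x y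
    using inj_on_eq_iff[OF bij_betw_imp_inj_on[OF e]] that by blast
  let ?c = "\<lambda>x. e (c x)"
  have rel: "(x, y) \<in> r \<longleftrightarrow> (?c x, ?c y) \<in> map_prod ?c ?c ` r"
    if r: "r \<in> set (rels S)" and xy: "x \<in> base S" "y \<in> base S" "?c x \<noteq> ?c y" for r x y
  proof
    \<comment> \<open>A pair in the image comes from some \<open>u\<close>, \<open>v\<close> in the
      classes of \<open>x\<close>, \<open>y\<close>; membership of either pair in \<open>r\<close>
      is decided by the same representatives.\<close>
    assume "(?c x, ?c y) \<in> map_prod ?c ?c ` r"
    then obtain u v where uv: "(u, v) \<in> r" "?c x = ?c u" "?c y = ?c v" by auto
    have "r \<subseteq> base S \<times> base S" using S(1) r by (simp add: binary_structure_def)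
    then have uv': "u \<in> base S" "v \<in> base S" using uv(1) by auto
    have e: "c x = c u" "c y = c v" using ec xy uv uv' by blast+
    have "c x \<noteq> c y" using xy(3) by auto
    then show "(x, y) \<in> r" using c(2)[OF r xy(1,2)] c(2)[OF r uv'] e uv(1) by simp
  qed (force intro: rev_image_eqI)
  have im: "?c ` base S = {..<card ?A}"
    using bij_betw_imp_surj_on[OF e] by (simp add: image_image atLeast0LessThan)
  have "quotient_map S (card ?A) ?c"
    unfolding quotient_map_def by (intro conjI ballI impI im rel)
  then show ?thesis using c(3) \<open>card ?A \<le> N\<close> by blast
qed

text \<open>On at most one point a relation is determined by whether it is empty, so any bijection
  of the bases is an isomorphism.\<close>

lemma isomorphic_subsingleton:
  assumes S: "binary_structure k S" "finite (base S)"
    and T: "binary_structure k T" "finite (base T)"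
    and card: "card (base S) = card (base T)" "card (base S) < 2"
    and ne: "map (\<lambda>r. r \<noteq> {}) (rels S) = map (\<lambda>r. r \<noteq> {}) (rels T)"
  shows "isomorphic S T"
proof -
  obtain p where p: "bij_betw p (base S) (base T)"
    using finite_same_card_bij S(2) T(2) card(1) by blast
  have rel: "(x, y) \<in> rels U ! i \<longleftrightarrow> rels U ! i \<noteq> {}"
    if U: "binary_structure k U" "finite (base U)" "card (base U) < 2"
      and xy: "x \<in> base U" "y \<in> base U" "i < k" for U :: "'c bstruct" and x y i
  proof
    have "card (base U) \<le> Suc 0" using U(3) by simp
    then have one: "u = v" if "u \<in> base U" "v \<in> base U" for u v
      using that card_le_Suc0_iff_eq[OF U(2)] by blast
    have sub: "rels U ! i \<subseteq> base U \<times> base U" using U(1) xy(3) by (simp add: binary_structure_def)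
    assume "rels U ! i \<noteq> {}"
    then obtain u v where uv: "(u, v) \<in> rels U ! i" by auto
    then have "u = x" "v = y" using one sub xy by auto
    then show "(x, y) \<in> rels U ! i" using uv by simp
  qed auto
  have len: "length (rels S) = k" "length (rels T) = k"
    using S T by (simp_all add: binary_structure_def)
  have "rels S ! i \<noteq> {} \<longleftrightarrow> rels T ! i \<noteq> {}" if "i < k" for i
    using arg_cong[OF ne, of "\<lambda>bs. bs ! i"] that len by simp
  moreover have "p x \<in> base T" if "x \<in> base S" for x using p that by (rule bij_betw_apply)
  ultimately have "(x, y) \<in> rels S ! i \<longleftrightarrow> (p x, p y) \<in> rels T ! i"
    if "i < k" "x \<in> base S" "y \<in> base S" for i x y
    using rel[OF S] rel[OF T] card that by simp
  then show ?thesis unfolding isomorphic_def using p len by auto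
qed

text \<open>Embeddings of the classes glue together: inside a class the given embedding decides, and
  \<open>cross\<close> says that between distinct classes both structures follow the same
  quotient.\<close>

lemma embeds_lexicographic_sum:
  assumes l: "length (rels S) = length (rels T)"
    and c: "\<And>x. x \<in> base S \<Longrightarrow> c x < m"
    and emb: "\<And>l. l < m \<Longrightarrow> embeds (restr S {x. c x = l}) (restr T {x. d x = (l::nat)})"
    and cross: "\<And>i x y u v. i < length (rels S) \<Longrightarrow> x \<in> base S \<Longrightarrow> y \<in> base S \<Longrightarrow>
      u \<in> base T \<Longrightarrow> v \<in> base T \<Longrightarrow> c x = d u \<Longrightarrow> c y = d v \<Longrightarrow> c x \<noteq> c y \<Longrightarrow>
      (x, y) \<in> rels S ! i \<longleftrightarrow> (u, v) \<in> rels T ! i"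
  shows "embeds S T"
proof -
  let ?S = "\<lambda>l. restr S {x. c x = l}" and ?T = "\<lambda>l. restr T {x. d x = l}"
  have "\<forall>l. \<exists>f. l < m \<longrightarrow> inj_on f (base (?S l)) \<and> f ` base (?S l) \<subseteq> base (?T l) \<and>
        (\<forall>i < length (rels S). \<forall>x \<in> base (?S l). \<forall>y \<in> base (?S l).
           (x, y) \<in> rels (?S l) ! i \<longleftrightarrow> (f x, f y) \<in> rels (?T l) ! i)"
    using emb unfolding embeds_iff length_rels_restr by meson
  then obtain f where f: "\<And>l. l < m \<Longrightarrow> inj_on (f l) (base (?S l))"
    "\<And>l. l < m \<Longrightarrow> f l ` base (?S l) \<subseteq> base (?T l)"
    "\<And>l i x y. l < m \<Longrightarrow> i < length (rels S) \<Longrightarrow> x \<in> base (?S l) \<Longrightarrow> y \<in> base (?S l) \<Longrightarrow>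
           (x, y) \<in> rels (?S l) ! i \<longleftrightarrow> (f l x, f l y) \<in> rels (?T l) ! i"
    by metis
  define g where "g x = f (c x) x" for x
  have g: "g x \<in> base T" "d (g x) = c x" if "x \<in> base S" for x
    using f(2)[OF c[OF that]] that by (auto simp: g_def)
  have "inj_on g (base S)"
  proof (rule inj_onI)
    fix x y assume xy: "x \<in> base S" "y \<in> base S" "g x = g y"
    then have e: "c x = c y" using g by metis
    show "x = y"
      using inj_onD[OF f(1)[OF c[OF xy(1)]], of x y] xy e by (simp add: g_def)
  qed
  moreover have "(x, y) \<in> rels S ! i \<longleftrightarrow> (g x, g y) \<in> rels T ! i"
    if "i < length (rels S)" "x \<in> base S" "y \<in> base S" for i x y
  proof (cases "c x = c y")
    case True
    have "d (f (c y) x) = c y" "d (f (c y) y) = c y"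
      using g(2)[OF that(2)] g(2)[OF that(3)] True by (simp_all add: g_def)
    then show ?thesis using f(3)[OF c[OF that(2)] that(1), of x y] that True l
      by (simp add: nth_restr g_def)
  next
    case False
    then show ?thesis using cross that g by metis
  qed
  ultimately show ?thesis unfolding embeds_iff using l g(1) by blast
qed

text \<open>The bound \<open>N\<close> leaves finitely many quotients. Over a common quotient, the
  classes lie strictly below a minimal bad sequence, hence compare well, and the classwise
  embeddings glue.\<close>

lemma bounded_indecomposables_good:
  fixes f :: "nat \<Rightarrow> 'a bstruct"
  assumes "\<And>n. binary_structure k (f n)" "\<And>n. finite (base (f n))"
    and "\<And>n A. A \<subseteq> base (f n) \<Longrightarrow> indecomposable (restr (f n) A) \<Longrightarrow> card A \<le> N"
  shows "\<exists>i j. i < j \<and> embeds (f i) (f j)"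
proof (rule ccontr)
  assume no: "\<not> ?thesis"
  \<comment> \<open>\<open>K\<close> is closed under restriction, so the classes of a member lie in
    \<open>K\<close> again, as \<open>below\<close> requires.\<close>
  define K where "K = {S :: 'a bstruct. binary_structure k S \<and> finite (base S) \<and>
    (\<forall>A \<subseteq> base S. indecomposable (restr S A) \<longrightarrow> card A \<le> N)}"
  have K_restr: "restr S A \<in> K" if "S \<in> K" for S A
    using that binary_structure_restr by (auto simp: K_def restr_restr)
  have "bad_seq K embeds f" using no assms by (auto simp: bad_seq_def K_def)
  then obtain g where g: "bad_seq K embeds g" and
    below: "\<And>h. \<not> bad_seq {x \<in> K. \<exists>n. embeds x (g n) \<and> card (base x) < card (base (g n))} embeds h"
    using minimal_bad_seq_below[of K embeds f "\<lambda>S. card (base S)"] embeds_trans by blast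
  have gK: "binary_structure k (g n)" "finite (base (g n))"
    "A \<subseteq> base (g n) \<Longrightarrow> indecomposable (restr (g n) A) \<Longrightarrow> card A \<le> N" for n A
    using g by (auto simp: bad_seq_def K_def)
  have len: "length (rels (g n)) = k" for n using gK(1) by (simp add: binary_structure_def)
  have gbad: "\<not> embeds (g i) (g j)" if "i < j" for i j using g that by (simp add: bad_seq_def)
  define Z where "Z = {n. 2 \<le> card (base (g n))}"
  \<comment> \<open>Structures with at most one point have no quotient with two classes. Size and
    emptiness of each relation determine them up to isomorphism, so a bad sequence contains only
    finitely many.\<close>
  have "finite (- Z)"
  proof (rule ccontr)
    assume inf: "infinite (- Z)"
    define code where "code n = (card (base (g n)), map (\<lambda>r. r \<noteq> {}) (rels (g n)))" for n
    have "code ` (- Z) \<subseteq> {..2} \<times> {xs. set xs \<subseteq> UNIV \<and> length xs = k}"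
      using len by (auto simp: code_def Z_def)
    then have "finite (code ` (- Z))"
      by (rule finite_subset) (intro finite_SigmaI finite_lists_length_eq; simp)
    from pigeonhole_infinite[OF inf this] obtain n0 where
      inf': "infinite {n \<in> - Z. code n = code n0}" by blast
    then obtain i where i: "i \<in> - Z" "code i = code n0"
      by (metis (mono_tags, lifting) Collect_empty_eq finite.emptyI)
    obtain j where j: "j > i" "j \<in> - Z" "code j = code n0"
      using inf' unfolding infinite_nat_iff_unbounded by blast
    have "isomorphic (g i) (g j)"
    proof (rule isomorphic_subsingleton)
      show "card (base (g i)) = card (base (g j))" "card (base (g i)) < 2"
        using i j by (simp_all add: code_def Z_def)
      show "map (\<lambda>r. r \<noteq> {}) (rels (g i)) = map (\<lambda>r. r \<noteq> {}) (rels (g j))"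
        using i j by (simp add: code_def)
    qed (rule gK)+
    then show False using gbad j(1) isomorphic_imp_embeds by blast
  qed
  then have infZ: "infinite Z" by (metis Compl_eq_Diff_UNIV finite_Diff2 infinite_UNIV_nat)
  have "\<forall>n. \<exists>m c. n \<in> Z \<longrightarrow> 2 \<le> m \<and> m \<le> N \<and> quotient_map (g n) m c"
    using indexed_quotient[OF gK(1,2)] gK(3) unfolding Z_def mem_Collect_eq by blast
  then obtain m c where m2: "\<And>n. n \<in> Z \<Longrightarrow> 2 \<le> m n" and mN: "\<And>n. n \<in> Z \<Longrightarrow> m n \<le> N"
    and mc: "\<And>n. n \<in> Z \<Longrightarrow> quotient_map (g n) (m n) (c n)"
    by metis
  have im: "c n ` base (g n) = {..<m n}" if "n \<in> Z" for n
    using mc[OF that] by (simp add: quotient_map_def)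
  have quot: "(x, y) \<in> r \<longleftrightarrow> (c n x, c n y) \<in> map_prod (c n) (c n) ` r"
    if "n \<in> Z" "r \<in> set (rels (g n))" "x \<in> base (g n)" "y \<in> base (g n)" "c n x \<noteq> c n y" for n r x y
    by (rule mc[OF that(1), unfolded quotient_map_def, THEN conjunct2, rule_format, OF that(2-)])
  \<comment> \<open>The numbered quotient of \<open>g n\<close>. On \<open>Z\<close> there are
    finitely many such codes, so infinitely many indices share one.\<close>
  define code where "code n = (m n, map (\<lambda>r. map_prod (c n) (c n) ` r) (rels (g n)))" for n
  have "code ` Z \<subseteq> {..N} \<times> {xs. set xs \<subseteq> Pow ({..<N} \<times> {..<N}) \<and> length xs = k}"
  proof
    fix z assume "z \<in> code ` Z"
    then obtain n where n: "n \<in> Z" "z = code n" by blast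
    have "map_prod (c n) (c n) ` r \<subseteq> {..<N} \<times> {..<N}" if "r \<in> set (rels (g n))" for r
    proof -
      have "r \<subseteq> base (g n) \<times> base (g n)" using gK(1)[of n] that by (simp add: binary_structure_def)
      then have "map_prod (c n) (c n) ` r \<subseteq> {..<m n} \<times> {..<m n}" using im[OF n(1)] by fastforce
      then show ?thesis using mN[OF n(1)] by fastforce
    qed
    then show "z \<in> {..N} \<times> {xs. set xs \<subseteq> Pow ({..<N} \<times> {..<N}) \<and> length xs = k}"
      using mN[OF n(1)] len n(2) by (auto simp: code_def simp del: Pow_iff intro!: PowI)
  qed
  then have "finite (code ` Z)"
    by (rule finite_subset) (intro finite_SigmaI finite_lists_length_eq; simp)
  from pigeonhole_infinite[OF infZ this] obtain n0 where inf: "infinite {n \<in> Z. code n = code n0}"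
    by blast
  \<comment> \<open>\<open>?h n l\<close> is class \<open>l\<close> of term \<open>n\<close>. It is
    a proper part because some other class is nonempty, hence strictly smaller than
    \<open>g n\<close>.\<close>
  let ?h = "\<lambda>n l. restr (g n) {x. c n x = l}"
  have "?h n l \<in> {x \<in> K. \<exists>n. embeds x (g n) \<and> card (base x) < card (base (g n))}"
    if n: "n \<in> {n \<in> Z. code n = code n0}" and l: "l < m n0" for n l
  proof -
    have nZ: "n \<in> Z" and mn: "m n = m n0" using n by (auto simp: code_def)
    have "?h n l \<in> K" using g K_restr by (simp add: bad_seq_def)
    moreover have "embeds (?h n l) (g n)"
      using embeds_restr[of "base (g n) \<inter> {x. c n x = l}" "g n"] gK(1)[of n]
      by (auto simp: embeds_iff restr_def)
    moreover have "card (base (?h n l)) < card (base (g n))"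
    proof (rule psubset_card_mono[OF gK(2)])
      have "\<exists>l'. l' < m n \<and> l' \<noteq> l"
        using m2[OF nZ] by (intro exI[of _ "if l = 0 then 1 else 0"]) auto
      then obtain l' where l': "l' \<in> c n ` base (g n)" "l' \<noteq> l" using im[OF nZ] by auto
      then obtain x where "x \<in> base (g n)" "c n x = l'" by auto
      then show "base (?h n l) \<subset> base (g n)" using l'(2) by auto
    qed
    ultimately show ?thesis by blast
  qed
  from finite_product_good[of _ "m n0" ?h, OF inf this below] obtain i j where
    ij: "i \<in> Z" "j \<in> Z" "i < j" "code i = code n0" "code j = code n0"
    and le: "\<And>l. l < m n0 \<Longrightarrow> embeds (?h i l) (?h j l)" by blast
  have "embeds (g i) (g j)"
  proof (rule embeds_lexicographic_sum[OF _ _ le])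
    show "length (rels (g i)) = length (rels (g j))" using len by simp
    show "c i x < m n0" if "x \<in> base (g i)" for x
      using im[OF ij(1)] that ij(4) by (auto simp: code_def)
    fix l x y u v
    assume a: "l < length (rels (g i))" "x \<in> base (g i)" "y \<in> base (g i)" "u \<in> base (g j)"
      "v \<in> base (g j)" "c i x = c j u" "c i y = c j v" "c i x \<noteq> c i y"
    have "map (\<lambda>r. map_prod (c i) (c i) ` r) (rels (g i)) ! l =
        map (\<lambda>r. map_prod (c j) (c j) ` r) (rels (g j)) ! l" using ij by (simp add: code_def)
    then have eq: "map_prod (c i) (c i) ` (rels (g i) ! l) = map_prod (c j) (c j) ` (rels (g j) ! l)"
      using a(1) len by simp
    have mem: "rels (g i) ! l \<in> set (rels (g i))" "rels (g j) ! l \<in> set (rels (g j))"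
      using a(1) len by simp_all
    have ne: "c j u \<noteq> c j v" using a(6-8) by simp
    \<comment> \<open>Between distinct classes both sides are read off from the common quotient
      relation \<open>eq\<close>.\<close>
    show "(x, y) \<in> rels (g i) ! l \<longleftrightarrow> (u, v) \<in> rels (g j) ! l"
      by (simp only: quot[OF ij(1) mem(1) a(2,3,8)] quot[OF ij(2) mem(2) a(4,5) ne] a(6,7) eq)
  qed
  then show False using gbad ij(3) by blast
qed


section \<open>Minimal classes\<close>

lemma Ind_OmegaE:
  assumes "X \<in> Ind_Omega k"
  obtains S :: "nat bstruct" where "X = iso_type S" "binary_structure k S" "finite (base S)"
    "indecomposable S"
  using assms unfolding Ind_Omega_def by blast

lemma down_representatives:
  assumes "X \<in> down k C" "C \<subseteq> Ind_Omega k"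
  shows "\<exists>(S :: nat bstruct) (T :: nat bstruct). X = iso_type S \<and> binary_structure k S \<and> finite (base S) \<and>
    iso_type T \<in> C \<and> binary_structure k T \<and> embeds S T"
proof -
  obtain S :: "nat bstruct" where S: "X = iso_type S" "binary_structure k S" "finite (base S)"
    using assms(1) unfolding down_def Omega_def by blast
  obtain Y where Y: "Y \<in> C" "emb_le X Y" using assms(1) by (auto simp: down_def)
  obtain T :: "nat bstruct" where T: "Y = iso_type T" "binary_structure k T"
    using Y(1) assms(2) by (blast elim: Ind_OmegaE)
  have "embeds S T" using Y(2) S T emb_le_iso_type_iff by simp
  moreover have "iso_type T \<in> C" using T(1) Y(1) by simp
  ultimately show ?thesis using S T(2) by blast
qed

text \<open>Cardinality is invariant under isomorphism, so one representative per type suffices.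
  This supplies the bound for \<open>bounded_indecomposables_good\<close>.\<close>

lemma finite_bounded_card:
  assumes "finite D" "D \<subseteq> Ind_Omega k"
  obtains N where
    "\<And>S :: nat bstruct. iso_type S \<in> D \<Longrightarrow> binary_structure k S \<Longrightarrow> card (base S) \<le> N"
proof -
  have "\<forall>X \<in> D. \<exists>S :: nat bstruct. X = iso_type S \<and> binary_structure k S"
    using assms(2) by (blast elim: Ind_OmegaE)
  then obtain T :: "itype \<Rightarrow> nat bstruct" where
    T: "\<And>X. X \<in> D \<Longrightarrow> X = iso_type (T X) \<and> binary_structure k (T X)" by metis
  show thesis
  proof
    fix S :: "nat bstruct" assume S: "iso_type S \<in> D" "binary_structure k S"
    then have "isomorphic S (T (iso_type S))" using T iso_type_eq_iff by metis
    then have "card (base S) = card (base (T (iso_type S)))" by (rule isomorphic_card)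
    also have "\<dots> \<le> Max ((\<lambda>X. card (base (T X))) ` D)" using assms(1) S by (intro Max_ge) auto
    finally show "card (base S) \<le> Max ((\<lambda>X. card (base (T X))) ` D)" .
  qed
qed

text \<open>The members of \<open>C\<close> that omit \<open>S\<close> form a hereditary class, and
  \<open>T\<close> shows that it is proper. With \<open>S\<close> below a member of
  \<open>C\<close>, this covers all of \<open>down k C\<close>, and members of \<open>C\<close> by
  taking \<open>T\<close> to be \<open>S\<close>.\<close>

lemma minimal_class_cofinite:
  fixes S T :: "nat bstruct"
  assumes "minimal_class k C" "binary_structure k S"
    and "iso_type T \<in> C" "binary_structure k T" "embeds S T"
  shows "finite {X \<in> C. \<not> emb_le (iso_type S) X}" (is "finite ?D")
proof -
  have C: "hereditary_in_Ind k C" using assms(1) by (simp add: minimal_class_def)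
  have "iso_type T \<notin> ?D" using assms emb_le_iso_type_iff by blast
  then have "?D \<subset> C" using assms(3) by blast
  moreover have "hereditary_in_Ind k ?D"
    unfolding hereditary_in_Ind_def
  proof (intro conjI ballI impI)
    show "?D \<subseteq> Ind_Omega k" using C by (auto simp: hereditary_in_Ind_def)
    fix X Y assume XY: "X \<in> Ind_Omega k" "Y \<in> ?D" "emb_le X Y"
    then have "X \<in> C" "Y \<in> Ind_Omega k" using C by (auto simp: hereditary_in_Ind_def)
    obtain U V :: "nat bstruct" where UV: "X = iso_type U" "binary_structure k U"
      "Y = iso_type V" "binary_structure k V"
      using XY(1) \<open>Y \<in> Ind_Omega k\<close> by (blast elim: Ind_OmegaE)
    have "\<not> embeds S V" "embeds U V"
      using XY UV assms(2) emb_le_iso_type_iff by blast+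
    then have "\<not> embeds S U" using embeds_trans by blast
    then show "X \<in> ?D" using \<open>X \<in> C\<close> UV assms(2) emb_le_iso_type_iff by blast
  qed
  ultimately show ?thesis using assms(1) by (simp add: minimal_class_def)
qed

lemma down_wqo:
  assumes "minimal_class k C"
  shows "well_quasi_ordered_on (down k C) emb_le"
proof -
  have C: "hereditary_in_Ind k C" and sub: "C \<subseteq> Ind_Omega k"
    using assms by (auto simp: minimal_class_def hereditary_in_Ind_def)
  have rep: "\<exists>S :: nat bstruct. X = iso_type S \<and> binary_structure k S" if "X \<in> down k C" for X
    using that by (auto simp: down_def Omega_def)
  show ?thesis
    unfolding well_quasi_ordered_on_def
  proof (intro conjI ballI allI impI)
    show "emb_le X X" if X: "X \<in> down k C" for X
      using rep[OF X] emb_le_iso_type_iff isomorphic_imp_embeds isomorphic_refl by metis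
    show "emb_le X Z" if X: "X \<in> down k C" "Y \<in> down k C" "Z \<in> down k C" "emb_le X Y" "emb_le Y Z"
      for X Y Z
      using rep[OF X(1)] rep[OF X(2)] rep[OF X(3)] X(4,5) emb_le_iso_type_iff embeds_trans by metis
    fix f :: "nat \<Rightarrow> itype" assume f: "\<forall>n. f n \<in> down k C"
    show "\<exists>i j. i < j \<and> emb_le (f i) (f j)"
    proof (rule ccontr)
      assume no: "\<not> ?thesis"
      have "\<forall>n. \<exists>(S :: nat bstruct) (T :: nat bstruct). f n = iso_type S \<and> binary_structure k S \<and> finite (base S) \<and>
          iso_type T \<in> C \<and> binary_structure k T \<and> embeds S T"
        using f down_representatives[OF _ sub] by blast
      then obtain S T :: "nat \<Rightarrow> nat bstruct" where
        S: "\<And>n. f n = iso_type (S n)" "\<And>n. binary_structure k (S n)" "\<And>n. finite (base (S n))"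
        and T: "\<And>n. iso_type (T n) \<in> C" "\<And>n. binary_structure k (T n)" "\<And>n. embeds (S n) (T n)"
        by metis
      have bad: "\<not> embeds (S i) (S j)" if "i < j" for i j
        using no S emb_le_iso_type_iff that by metis
      \<comment> \<open>Every indecomposable restriction of a later term embeds into a member of
        \<open>C\<close> and omits \<open>S 0\<close>, so its type falls into this finite
        class.\<close>
      let ?D = "{X \<in> C. \<not> emb_le (iso_type (S 0)) X}"
      have "finite ?D" using minimal_class_cofinite assms S T by blast
      then obtain N where N: "\<And>U :: nat bstruct. iso_type U \<in> ?D \<Longrightarrow> binary_structure k U \<Longrightarrow>
          card (base U) \<le> N"
        using finite_bounded_card[of ?D k] sub by blast
      \<comment> \<open>The shift by one drops \<open>S 0\<close>, since it is the later terms that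
        omit it.\<close>
      have "\<exists>i j. i < j \<and> embeds (S (Suc i)) (S (Suc j))"
      proof (rule bounded_indecomposables_good)
        show "binary_structure k (S (Suc n))" "finite (base (S (Suc n)))" for n using S by auto
        fix n A assume A: "A \<subseteq> base (S (Suc n))" "indecomposable (restr (S (Suc n)) A)"
        let ?U = "restr (S (Suc n)) A"
        have U: "binary_structure k ?U" "finite (base ?U)"
          using S by (auto intro: binary_structure_restr)
        have emb: "embeds ?U (S (Suc n))" using A(1) by (rule embeds_restr)
        have "iso_type ?U \<in> Ind_Omega k" using U A(2) unfolding Ind_Omega_def by blast
        moreover have "emb_le (iso_type ?U) (iso_type (T (Suc n)))"
          using emb_le_iso_type_iff[OF U(1) T(2)] embeds_trans[OF emb T(3)] by simp
        ultimately have "iso_type ?U \<in> C" using C T(1) unfolding hereditary_in_Ind_def by blast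
        moreover have "\<not> embeds (S 0) ?U" using embeds_trans emb bad[of 0 "Suc n"] by blast
        ultimately have "iso_type ?U \<in> ?D" using emb_le_iso_type_iff[OF S(2) U(1)] by simp
        from N[OF this U(1)] A(1) show "card A \<le> N" by (simp add: Int_absorb1)
      qed
      then show False using bad by auto
    qed
  qed
qed


section \<open>The limit structure\<close>

text \<open>A copy of \<open>T\<close> that literally extends \<open>S\<close> turns a chain of
  embeddings into a chain of inclusions, whose union can be formed.\<close>

lemma embeds_imp_extension:
  fixes S T :: "nat bstruct"
  assumes S: "binary_structure k S" and T: "binary_structure k T" "finite (base T)"
    and "embeds S T"
  obtains T' :: "nat bstruct" where "binary_structure k T'" "isomorphic T T'" "base S \<subseteq> base T'"
    "restr T' (base S) = S"
proof -
  obtain f where f: "inj_on f (base S)" "f ` base S \<subseteq> base T"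
    "\<forall>i < length (rels S). \<forall>x \<in> base S. \<forall>y \<in> base S.
      (x, y) \<in> rels S ! i \<longleftrightarrow> (f x, f y) \<in> rels T ! i"
    using assms(4) unfolding embeds_iff by blast
  have finS: "finite (base S)" using f(1,2) T(2) by (rule inj_on_finite)
  let ?B = "base T - f ` base S"
  have "infinite (- base S)" using finS by (simp add: finite_compl)
  then obtain X where X: "finite X" "card X = card ?B" "X \<subseteq> - base S"
    using infinite_arbitrarily_large by blast
  obtain h where h: "bij_betw h ?B X"
    using finite_same_card_bij[of ?B X] X T(2) by auto
  define g where "g y = (if y \<in> f ` base S then inv_into (base S) f y else h y)" for y
  have gf: "g (f x) = x" if "x \<in> base S" for x using that f(1) by (simp add: g_def)
  have "h y \<notin> base S" if "y \<in> ?B" for y using bij_betw_apply[OF h that] X(3) by blast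
  then have apart: "g (f x) \<noteq> g y" if "x \<in> base S" "y \<in> ?B" for x y
    using gf that by (auto simp: g_def)
  have "inj_on g (base T)"
  proof (rule inj_onI)
    fix y z assume yz: "y \<in> base T" "z \<in> base T" "g y = g z"
    then consider "y \<in> f ` base S" "z \<in> f ` base S" | "y \<in> ?B" "z \<in> ?B"
      using apart by (metis DiffI imageE)
    then show "y = z"
    proof cases
      case 1
      then show ?thesis using gf yz(3) by auto
    next
      case 2
      then have "h y = h z" using yz(3) by (simp add: g_def)
      then show ?thesis using 2 inj_onD[OF bij_betw_imp_inj_on[OF h]] by blast
    qed
  qed
  let ?T = "BStruct (g ` base T) (map (\<lambda>r. map_prod g g ` r) (rels T))"
  have rel: "(g x, g y) \<in> map_prod g g ` (rels T ! i) \<longleftrightarrow> (x, y) \<in> rels T ! i"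
    if "i < k" "x \<in> base T" "y \<in> base T" for i x y
  proof
    assume "(g x, g y) \<in> map_prod g g ` (rels T ! i)"
    then obtain u v where uv: "(u, v) \<in> rels T ! i" "g x = g u" "g y = g v" by auto
    have "rels T ! i \<subseteq> base T \<times> base T" using T(1) that(1) by (simp add: binary_structure_def)
    then have "u \<in> base T" "v \<in> base T" using uv(1) by auto
    then show "(x, y) \<in> rels T ! i" using uv that \<open>inj_on g (base T)\<close> by (metis inj_onD)
  qed (force intro: rev_image_eqI)
  have lS: "length (rels S) = k" and lT: "length (rels T) = k"
    using S T by (simp_all add: binary_structure_def)
  show thesis
  proof
    show "binary_structure k ?T" using T(1) by (fastforce simp: binary_structure_def)
    show "isomorphic T ?T"
      unfolding isomorphic_def using \<open>inj_on g (base T)\<close> rel lT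
      by (intro conjI exI[of _ g]) (auto simp: bij_betw_def)
    have sub: "base S \<subseteq> g ` base T"
    proof
      fix x assume "x \<in> base S"
      then have "x = g (f x)" "f x \<in> base T" using gf f(2) by auto
      then show "x \<in> g ` base T" by (rule image_eqI)
    qed
    then show "base S \<subseteq> base ?T" by simp
    have "map_prod g g ` (rels T ! i) \<inter> (base S \<times> base S) = rels S ! i" if i: "i < k" for i
    proof -
      have sS: "rels S ! i \<subseteq> base S \<times> base S" using S i by (simp add: binary_structure_def)
      have "(x, y) \<in> map_prod g g ` (rels T ! i) \<longleftrightarrow> (x, y) \<in> rels S ! i"
        if xy: "x \<in> base S" "y \<in> base S" for x y
      proof -
        have "f x \<in> base T" "f y \<in> base T" using f(2) xy by auto
        from rel[OF i this]
        have "(x, y) \<in> map_prod g g ` (rels T ! i) \<longleftrightarrow> (f x, f y) \<in> rels T ! i"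
          by (simp only: gf[OF xy(1)] gf[OF xy(2)])
        then show ?thesis using f(3) xy i lS by simp
      qed
      then show ?thesis using sS by (intro set_eqI) blast
    qed
    then show "restr ?T (base S) = S" using sub lS lT by (intro restr_eqI) simp_all
  qed
qed

text \<open>Each stage restricts to the preceding one, so later stages add no pairs on old points,
  and the union of the relations is correct on every stage.\<close>

lemma union_of_chain:
  fixes S :: "nat \<Rightarrow> 'a bstruct"
  assumes S: "\<And>n. binary_structure k (S n)"
    and chain: "\<And>n. base (S n) \<subseteq> base (S (Suc n))" "\<And>n. restr (S (Suc n)) (base (S n)) = S n"
  obtains R where "binary_structure k R" "base R = (\<Union>n. base (S n))"
    "\<And>n. restr R (base (S n)) = S n"
proof -
  let ?R = "BStruct (\<Union>n. base (S n)) (map (\<lambda>i. \<Union>n. rels (S n) ! i) [0..<k])"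
  have len: "length (rels (S n)) = k" for n using S by (simp add: binary_structure_def)
  have relsub: "rels (S n) ! i \<subseteq> base (S n) \<times> base (S n)" if "i < k" for n i
    using S[of n] that by (simp add: binary_structure_def)
  have mono: "base (S n) \<subseteq> base (S m)" if "n \<le> m" for n m
    using that chain(1) by (rule lift_Suc_mono_le[rotated])
  have restr: "restr (S m) (base (S n)) = S n" if "n \<le> m" for n m
    using that
  proof (induction rule: dec_induct)
    case base
    show ?case using S by (rule restr_base)
  next
    case (step m)
    have "restr (S (Suc m)) (base (S n)) = restr (restr (S (Suc m)) (base (S m))) (base (S n))"
      using mono step by (simp add: restr_restr)
    then show ?case using chain(2) step by simp
  qed
  have rel: "rels (S n) ! i = rels (S m) ! i \<inter> (base (S n) \<times> base (S n))"
    if "n \<le> m" "i < k" for n m i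
    using restr[OF that(1)] nth_restr[of i "S m" "base (S n)"] len that(2) by simp
  show thesis
  proof
    show "binary_structure k ?R" using relsub by (fastforce simp: binary_structure_def)
    show "base ?R = (\<Union>n. base (S n))" by simp
    fix n
    have "(\<Union>m. rels (S m) ! i) \<inter> (base (S n) \<times> base (S n)) = rels (S n) ! i" if i: "i < k" for i
    proof (intro equalityI subsetI)
      fix z assume "z \<in> (\<Union>m. rels (S m) ! i) \<inter> (base (S n) \<times> base (S n))"
      then obtain m where "z \<in> rels (S m) ! i" "z \<in> base (S n) \<times> base (S n)" by blast
      then show "z \<in> rels (S n) ! i" using rel[OF _ i, of n m] rel[OF _ i, of m n] nat_le_linear by blast
    qed (use relsub[OF i] in blast)
    then show "restr ?R (base (S n)) = S n" using len by (intro restr_eqI) auto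
  qed
qed

lemma minimal_class_limit:
  assumes "minimal_class k C"
  shows "\<exists>R :: nat bstruct. binary_structure k R \<and> infinite (base R) \<and> indecomposable R \<and>
       Age R = down k C"
proof -
  have sub: "C \<subseteq> Ind_Omega k" and inf: "infinite C"
    using assms by (auto simp: minimal_class_def hereditary_in_Ind_def)
  let ?P = "\<lambda>n S :: nat bstruct. binary_structure k S \<and> finite (base S) \<and> iso_type S \<in> C"
  let ?Q = "\<lambda>n S T :: nat bstruct. base S \<subset> base T \<and> restr T (base S) = S"
  have "\<exists>S. \<forall>n. ?P n (S n) \<and> ?Q n (S n) (S (Suc n))"
  proof (rule dependent_nat_choice)
    obtain X where "X \<in> C" using inf by (metis ex_in_conv finite.emptyI)
    then show "\<exists>S. ?P 0 S" using sub by (blast elim: Ind_OmegaE)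
    fix S :: "nat bstruct" and n :: nat assume S: "?P n S"
    have "finite {X \<in> C. \<not> emb_le (iso_type S) X}"
      using minimal_class_cofinite[OF assms, of S S] S isomorphic_refl isomorphic_imp_embeds by blast
    \<comment> \<open>The type of \<open>S\<close> itself is excluded along with the finitely many
      members that omit \<open>S\<close>; this makes the extension strict.\<close>
    then have "finite (insert (iso_type S) {X \<in> C. \<not> emb_le (iso_type S) X})" by simp
    then obtain X where X: "X \<in> C" "emb_le (iso_type S) X" "X \<noteq> iso_type S"
      using inf by (metis (mono_tags, lifting) finite_subset insertI1 insertI2 mem_Collect_eq subsetI)
    then obtain T :: "nat bstruct" where T: "X = iso_type T" "binary_structure k T" "finite (base T)"
      using sub by (blast elim: Ind_OmegaE)
    have "embeds S T" using X T S emb_le_iso_type_iff by blast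
    then obtain T' where T': "binary_structure k T'" "isomorphic T T'" "base S \<subseteq> base T'"
      "restr T' (base S) = S"
      using embeds_imp_extension S T by metis
    have iso: "iso_type T' = X" using T T' iso_type_eq_iff by metis
    have "base S \<noteq> base T'"
    proof
      assume e: "base S = base T'"
      have "S = T'" using restr_base[OF T'(1)] T'(4) e by metis
      then show False using iso X(3) by simp
    qed
    moreover have "finite (base T')" using T T' isomorphic_finite by blast
    ultimately show "\<exists>T. ?P (Suc n) T \<and> ?Q n S T" using T' iso X(1) by blast
  qed
  then obtain S where PQ: "\<forall>n. ?P n (S n) \<and> ?Q n (S n) (S (Suc n))" ..
  from PQ have S: "\<And>n. binary_structure k (S n)" "\<And>n. finite (base (S n))"
    "\<And>n. iso_type (S n) \<in> C"
    and chain: "\<And>n. base (S n) \<subset> base (S (Suc n))" "\<And>n. restr (S (Suc n)) (base (S n)) = S n"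
    by auto
  obtain R where R: "binary_structure k R" "base R = (\<Union>n. base (S n))"
    "\<And>n. restr R (base (S n)) = S n"
    using union_of_chain[where S = S, OF S(1) psubset_imp_subset[OF chain(1)] chain(2)] by blast
  \<comment> \<open>Strictly increasing sizes give both an infinite union and pairwise distinct
    types of the stages.\<close>
  have smono: "strict_mono (\<lambda>n. card (base (S n)))"
    unfolding strict_mono_Suc_iff by (intro allI psubset_card_mono S(2) chain(1))
  have mono: "base (S n) \<subseteq> base (S m)" if "n \<le> m" for n m
    by (rule lift_Suc_mono_le[of "\<lambda>n. base (S n)", OF psubset_imp_subset[OF chain(1)] that])
  have cover: "\<exists>n. A \<subseteq> base (S n)" if "finite A" "A \<subseteq> base R" for A
    using that
  proof (induction A rule: finite_induct)
    case (insert x A)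
    then obtain n m where "A \<subseteq> base (S n)" "x \<in> base (S m)" using R(2) by auto
    then have "insert x A \<subseteq> base (S (max n m))"
      using mono[of n "max n m"] mono[of m "max n m"] by auto
    then show ?case by blast
  qed simp
  have restrR: "restr R A = restr (S n) A" if "A \<subseteq> base (S n)" for A n
    using restr_restr[OF that, of R] R(3) by simp
  have "infinite (base R)"
  proof
    assume fin: "finite (base R)"
    have "card (base (S n)) \<le> card (base R)" for n using fin R(2) by (intro card_mono) auto
    \<comment> \<open>Stage \<open>n\<close> has at least \<open>n\<close> points, so the stage with
      index \<open>Suc (card (base R))\<close> is too large for \<open>R\<close>.\<close>
    moreover have "Suc (card (base R)) \<le> card (base (S (Suc (card (base R)))))"
      using smono by (rule strict_mono_imp_increasing)
    ultimately show False by (metis Suc_n_not_le_n le_trans)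
  qed
  moreover have "indecomposable R"
    unfolding indecomposable_def
  proof (intro allI impI, rule ccontr)
    fix A assume A: "interval R A" and n: "\<not> (A = {} \<or> (\<exists>x. A = {x}) \<or> A = base R)"
    have AR: "A \<subseteq> base R" using A by (simp add: interval_def)
    \<comment> \<open>Two points of \<open>A\<close> and one outside witness that the interval is
      nontrivial; a stage containing all three would have a nontrivial interval too.\<close>
    obtain a where a: "a \<in> A" using n by blast
    obtain b where b: "b \<in> A" "b \<noteq> a" using n a by blast
    obtain c where c: "c \<in> base R" "c \<notin> A" using n AR by blast
    obtain m where m: "{a, b, c} \<subseteq> base (S m)" using cover[of "{a, b, c}"] a b c AR by auto
    have "interval (S m) (A \<inter> base (S m))" using interval_restr[OF A, of "base (S m)"] R(3) by simp
    moreover have "indecomposable (S m)"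
    proof -
      from S(3) sub have "iso_type (S m) \<in> Ind_Omega k" by (rule subsetD[rotated])
      then obtain T :: "nat bstruct" where T: "iso_type (S m) = iso_type T" "binary_structure k T"
        "finite (base T)" "indecomposable T" by (rule Ind_OmegaE)
      have "isomorphic (S m) T" using iso_type_eq_iff[OF S(1) T(2)] T(1) by simp
      then show ?thesis using T(4) by (rule indecomposable_isomorphic)
    qed
    ultimately have "A \<inter> base (S m) = {} \<or> (\<exists>x. A \<inter> base (S m) = {x}) \<or>
        A \<inter> base (S m) = base (S m)"
      unfolding indecomposable_def by simp
    moreover have "a \<in> A \<inter> base (S m)" "b \<in> A \<inter> base (S m)" "c \<in> base (S m)" using a b m by auto
    ultimately show False using b(2) c(2) by (metis Int_iff empty_iff singletonD)
  qed
  moreover have "Age R \<subseteq> down k C"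
  proof
    fix X assume "X \<in> Age R"
    then obtain A where A: "A \<subseteq> base R" "finite A" "X = iso_type (restr R A)" by (auto simp: Age_def)
    obtain n where n: "A \<subseteq> base (S n)" using cover A by blast
    have bs: "binary_structure k (restr (S n) A)" using S(1) by (rule binary_structure_restr)
    have "X = iso_type (restr (S n) A)" using A(3) restrR[OF n] by simp
    moreover have "finite (base (restr (S n) A))" using A(2) by simp
    ultimately have "X \<in> Omega k" using bs unfolding Omega_def by blast
    have "emb_le X (iso_type (S n))"
      using emb_le_iso_type_iff[OF bs S(1)] embeds_restr[OF n] \<open>X = iso_type (restr (S n) A)\<close>
      by simp
    with \<open>X \<in> Omega k\<close> show "X \<in> down k C" using S(3) by (auto simp: down_def)
  qed
  moreover have "down k C \<subseteq> Age R"
  proof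
    fix X assume "X \<in> down k C"
    then obtain U T :: "nat bstruct" where U: "X = iso_type U" "binary_structure k U" "finite (base U)"
      "iso_type T \<in> C" "binary_structure k T" "embeds U T"
      using down_representatives[OF _ sub] by blast
    have fin: "finite {Y \<in> C. \<not> emb_le X Y}"
      using minimal_class_cofinite[OF assms U(2,4,5,6)] U(1) by simp
    \<comment> \<open>The stages supply infinitely many members of \<open>C\<close>, and only
      finitely many members omit \<open>X\<close>; hence \<open>X\<close> embeds into some
      stage.\<close>
    have "inj (\<lambda>n. iso_type (S n))"
    proof (rule injI)
      fix i j assume "iso_type (S i) = iso_type (S j)"
      then have "card (base (S i)) = card (base (S j))"
        using iso_type_eq_iff[OF S(1) S(1)] isomorphic_card by blast
      then show "i = j" using strict_mono_eq[OF smono] by blast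
    qed
    then have "infinite (range (\<lambda>n. iso_type (S n)))" by (rule range_inj_infinite)
    then have "\<not> range (\<lambda>n. iso_type (S n)) \<subseteq> {Y \<in> C. \<not> emb_le X Y}"
      using fin finite_subset by blast
    then obtain n where "emb_le X (iso_type (S n))" using S(3) by blast
    then have "embeds U (S n)" using emb_le_iso_type_iff[OF U(2) S(1)] U(1) by simp
    then obtain A where A: "A \<subseteq> base (S n)" "isomorphic U (restr (S n) A)"
      unfolding embeds_def by blast
    have "X = iso_type (restr R A)"
      using iso_type_eq_iff[OF U(2) binary_structure_restr[OF S(1)]] A(2) U(1) restrR[OF A(1)]
      by simp
    moreover have "A \<subseteq> base R" using A(1) R(2) by blast
    moreover have "finite A" using A(1) S(2) by (rule finite_subset)
    ultimately show "X \<in> Age R" by (auto simp: Age_def)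
  qed
  ultimately show ?thesis using R(1) by blast
qed

theorem theorem5p15:
  fixes k :: nat and C :: "itype set"
  assumes "k \<ge> 1"
    and "minimal_class k C"
  shows "well_quasi_ordered_on (down k C) emb_le \<and>
    (\<exists>R :: nat bstruct. binary_structure k R \<and> infinite (base R) \<and> indecomposable R \<and>
       Age R = down k C)"
  using down_wqo minimal_class_limit assms(2) by blast

end
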